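(* The group $CT_{\infty}$ coincides with the group $CT_{int}(\mathbb{Z})$.
   Context: For integers $0\le r<m$ write $r(m)=r+m\mathbb{Z}$. If $r_1(m_1)\cap r_2(m_2)=\emptyset$, the class transposition $\tau_{r_1(m_1),r_2(m_2)}$ is the permutation of $\mathbb{Z}$ interchanging $r_1+km_1$ and $r_2+km_2$ for every $k\in\mathbb{Z}$ and fixing every other integer. It is horizontal if $m_1=m_2$. $CT_\infty$ denotes the subgroup of $\mathrm{Sym}(\mathbb{Z})$ generated by all horizontal class transpositions. A mapping $f:\mathbb{Z}\to\mathbb{Z}$ is called affine on the set of residue classes if there is a positive integer $m$ such that the restriction of $f$ to each residue class $r(m)\in\mathbb{Z}/m\mathbb{Z}$ is affine, i.e. given by $n\mapsto (a_{r(m)}\cdot n+b_{r(m)})/c_{r(m)}$ with $a_{r(m)},b_{r(m)},c_{r(m)}\in\mathbb{Z}$ depending on $r(m)$. The least possible such $m$ is called the modulus of $f$. The coefficients are normalized so that $\gcd(a_{r(m)},b_{r(m)},c_{r(m)})=1$ and $c_{r(m)}>0$. With $m$ the modulus of $f$, the divisor of $f$ is $\mathrm{lcm}\{c_{r(m)} : r(m)\in\mathbb{Z}/m\mathbb{Z}\}$. The mapping $f$ is called integral if its divisor is $1$. $CT_{int}(\mathbb{Z})$ denotes the subgroup of $\mathrm{Sym}(\mathbb{Z})$ generated by all integral class transpositions. *)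

theory Defs
  imports Complex_Main "HOL-Algebra.Bij" "HOL-Algebra.Generated_Groups"
begin

definition residue_class :: "int \<Rightarrow> int \<Rightarrow> int set" where
  "residue_class r m = {r + k * m | k. True}"

definition class_transposition :: "int \<Rightarrow> int \<Rightarrow> int \<Rightarrow> int \<Rightarrow> int \<Rightarrow> int" where
  "class_transposition r1 m1 r2 m2 n =
     (if n \<in> residue_class r1 m1 then r2 + (n - r1) div m1 * m2
      else if n \<in> residue_class r2 m2 then r1 + (n - r2) div m2 * m1
      else n)"

definition disjoint_classes :: "int \<Rightarrow> int \<Rightarrow> int \<Rightarrow> int \<Rightarrow> bool" where
  "disjoint_classes r1 m1 r2 m2 \<longleftrightarrow>
     0 \<le> r1 \<and> r1 < m1 \<and> 0 \<le> r2 \<and> r2 < m2 \<and>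
     residue_class r1 m1 \<inter> residue_class r2 m2 = {}"

lemma class_transposition_swaps:
  assumes "disjoint_classes r1 m1 r2 m2"
  shows "class_transposition r1 m1 r2 m2 (r1 + k * m1) = r2 + k * m2"
    and "class_transposition r1 m1 r2 m2 (r2 + k * m2) = r1 + k * m1"
    and "n \<notin> residue_class r1 m1 \<union> residue_class r2 m2 \<Longrightarrow>
           class_transposition r1 m1 r2 m2 n = n"
proof -
  have pos: "m1 \<noteq> 0" "m2 \<noteq> 0" using assms by (auto simp: disjoint_classes_def)
  have in1: "r1 + k * m1 \<in> residue_class r1 m1" for k by (auto simp: residue_class_def)
  have in2: "r2 + k * m2 \<in> residue_class r2 m2" for k by (auto simp: residue_class_def)
  have notin: "r2 + k * m2 \<notin> residue_class r1 m1" for k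
    using assms in2[of k] by (auto simp: disjoint_classes_def)
  show "class_transposition r1 m1 r2 m2 (r1 + k * m1) = r2 + k * m2"
    using in1[of k] pos by (simp add: class_transposition_def)
  show "class_transposition r1 m1 r2 m2 (r2 + k * m2) = r1 + k * m1"
    using in2[of k] notin[of k] pos by (simp add: class_transposition_def)
  show "class_transposition r1 m1 r2 m2 n = n"
    if "n \<notin> residue_class r1 m1 \<union> residue_class r2 m2"
    using that by (simp add: class_transposition_def)
qed

lemma class_transposition_in_Sym:
  assumes "disjoint_classes r1 m1 r2 m2"
  shows "class_transposition r1 m1 r2 m2 \<in> carrier (BijGroup UNIV)"
proof -
  let ?t = "class_transposition r1 m1 r2 m2"
  have "?t (?t n) = n" for n
  proof (cases "n \<in> residue_class r1 m1 \<union> residue_class r2 m2")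
    case True
    then obtain k where "n = r1 + k * m1 \<or> n = r2 + k * m2"
      by (auto simp: residue_class_def)
    then show ?thesis using class_transposition_swaps(1,2)[OF assms] by auto
  next
    case False
    then show ?thesis using class_transposition_swaps(3)[OF assms] by simp
  qed
  then have "bij ?t" by (intro o_bij[of ?t ?t]) (auto simp: fun_eq_iff)
  then show ?thesis by (simp add: BijGroup_def Bij_def)
qed

definition class_transpositions :: "(int \<Rightarrow> int) set" where
  "class_transpositions =
     {class_transposition r1 m1 r2 m2 | r1 m1 r2 m2. disjoint_classes r1 m1 r2 m2}"

definition horizontal_class_transpositions :: "(int \<Rightarrow> int) set" where
  "horizontal_class_transpositions =
     {class_transposition r1 m1 r2 m2 | r1 m1 r2 m2. disjoint_classes r1 m1 r2 m2 \<and> m1 = m2}"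

definition affine_with_coeffs :: "(int \<Rightarrow> int) \<Rightarrow> int set \<Rightarrow> int \<Rightarrow> int \<Rightarrow> int \<Rightarrow> bool" where
  "affine_with_coeffs f S a b c \<longleftrightarrow>
     c \<noteq> 0 \<and> (\<forall>n\<in>S. (of_int (f n) :: rat) = (of_int a * of_int n + of_int b) / of_int c)"

definition affine_mod :: "(int \<Rightarrow> int) \<Rightarrow> nat \<Rightarrow> bool" where
  "affine_mod f m \<longleftrightarrow>
     m > 0 \<and> (\<forall>r\<in>{0..<int m}. \<exists>a b c. affine_with_coeffs f (residue_class r (int m)) a b c)"

definition residue_class_wise_affine :: "(int \<Rightarrow> int) \<Rightarrow> bool" where
  "residue_class_wise_affine f \<longleftrightarrow> (\<exists>m. affine_mod f m)"

definition rcwa_modulus :: "(int \<Rightarrow> int) \<Rightarrow> nat" where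
  "rcwa_modulus f = (LEAST m. affine_mod f m)"

definition normalized_coeffs :: "(int \<Rightarrow> int) \<Rightarrow> int set \<Rightarrow> int \<times> int \<times> int \<Rightarrow> bool" where
  "normalized_coeffs f S = (\<lambda>(a, b, c).
     affine_with_coeffs f S a b c \<and> gcd a (gcd b c) = 1 \<and> c > 0)"

lemma normalized_coeffs_unique:
  assumes "m > 0"
    and "normalized_coeffs f (residue_class r m) p" "normalized_coeffs f (residue_class r m) q"
  shows "p = q"
proof -
  obtain a b c where p: "p = (a, b, c)" by (cases p)
  obtain a' b' c' where q: "q = (a', b', c')" by (cases q)
  have c: "c > 0" "gcd a (gcd b c) = 1" and c': "c' > 0" "gcd a' (gcd b' c') = 1"
    using assms by (auto simp: normalized_coeffs_def p q)
  have clear: "z * y = x * n + w"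
    if "(of_int y :: rat) = (of_int x * of_int n + of_int w) / of_int z" "z > 0" for x y z w n :: int
  proof -
    have "(of_int (z * y) :: rat) = of_int (x * n + w)" using that by (simp add: field_simps)
    then show ?thesis by (simp only: of_int_eq_iff)
  qed
  have lin: "c * f n = a * n + b" "c' * f n = a' * n + b'" if "n \<in> residue_class r m" for n
    using assms that c(1) c'(1)
    by (auto simp: normalized_coeffs_def affine_with_coeffs_def p q intro!: clear)
  have cross: "c' * (a * n + b) = c * (a' * n + b')" if "n \<in> residue_class r m" for n
    using lin[OF that] by (metis mult.left_commute)
  have "r + 0 * m \<in> residue_class r m" "r + 1 * m \<in> residue_class r m"
    unfolding residue_class_def by blast+
  then have "c' * (a * r + b) = c * (a' * r + b')"
    and "c' * (a * (r + m) + b) = c * (a' * (r + m) + b')"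
    using cross by auto
  then have "m * (c' * a) = m * (c * a')" and 1: "c' * (a * r + b) = c * (a' * r + b')"
    by algebra+
  then have ca: "c' * a = c * a'" using \<open>m > 0\<close> by simp
  from 1 ca have cb: "c' * b = c * b'" by algebra
  have "c dvd gcd (c' * a) (gcd (c' * b) (c' * c))" by (simp add: ca cb)
  moreover have "gcd (c' * a) (gcd (c' * b) (c' * c)) = c' * gcd a (gcd b c)"
    using c'(1) by (simp add: gcd_mult_left abs_mult)
  ultimately have 2: "c dvd c'" using c by simp
  have "c' dvd gcd (c * a') (gcd (c * b') (c * c'))" by (simp flip: ca cb)
  moreover have "gcd (c * a') (gcd (c * b') (c * c')) = c * gcd a' (gcd b' c')"
    using c(1) by (simp add: gcd_mult_left abs_mult)
  ultimately have "c' dvd c" using c' by simp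
  with 2 have "c = c'" using c c' by (simp add: zdvd_antisym_nonneg)
  then show ?thesis using ca cb c by (simp add: p q)
qed

definition class_denominator :: "(int \<Rightarrow> int) \<Rightarrow> int \<Rightarrow> int \<Rightarrow> int" where
  "class_denominator f r m = snd (snd (THE p. normalized_coeffs f (residue_class r m) p))"

definition rcwa_divisor :: "(int \<Rightarrow> int) \<Rightarrow> int" where
  "rcwa_divisor f =
     Lcm ((\<lambda>r. class_denominator f r (int (rcwa_modulus f))) ` {0..<int (rcwa_modulus f)})"

definition rcwa_integral :: "(int \<Rightarrow> int) \<Rightarrow> bool" where
  "rcwa_integral f \<longleftrightarrow> residue_class_wise_affine f \<and> rcwa_divisor f = 1"

text \<open>Subgroups of the symmetric group on the integers, given by their carriers.\<close>

definition CT_inf :: "(int \<Rightarrow> int) set" where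
  "CT_inf = generate (BijGroup UNIV) horizontal_class_transpositions"

definition CT_int :: "(int \<Rightarrow> int) set" where
  "CT_int = generate (BijGroup UNIV) {f \<in> class_transpositions. rcwa_integral f}"

end

theory Submission imports Defs begin

text \<open>
  The two groups have the same generators. A class transposition acts on its two classes with
  slopes \<open>m2 / m1\<close> and \<open>m1 / m2\<close>. If it is integral, both slopes are integers
  (\<open>integral_class_transposition_dvd\<close>), and positive integers that are inverse to each other
  force \<open>m1 = m2\<close>. Conversely, a horizontal class transposition is a translation on each
  residue class modulo \<open>m1\<close>.

  The divisor is read off at the least modulus, which need not be known explicitly. The lemma
  \<open>rcwa_integral_iff\<close> avoids computing it: integrality amounts to having integer slopes on the
  residue classes modulo some \<open>m\<close>, because any two moduli see the same slope on a common
  arithmetic progression, and an affine map that sends an integer to an integer and whose slope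
  is an integer has normalized denominator \<open>1\<close>.
\<close>

lemma affine_with_coeffs_iff:
  "affine_with_coeffs f S a b c \<longleftrightarrow> c \<noteq> 0 \<and> (\<forall>n\<in>S. c * f n = a * n + b)"
proof -
  have "(of_int (f n) :: rat) = (of_int a * of_int n + of_int b) / of_int c
        \<longleftrightarrow> c * f n = a * n + b" if "c \<noteq> 0" for n
  proof -
    have "(of_int (f n) :: rat) = (of_int a * of_int n + of_int b) / of_int c
          \<longleftrightarrow> (of_int (c * f n) :: rat) = of_int (a * n + b)"
      using that by (simp add: field_simps)
    then show ?thesis by (simp only: of_int_eq_iff)
  qed
  then show ?thesis unfolding affine_with_coeffs_def by blast
qed

lemma add_mult_mem_residue_class_iff: "n + k * m \<in> residue_class r m \<longleftrightarrow> n \<in> residue_class r m"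
proof -
  have "n + k * m = r + j * m \<longleftrightarrow> n = r + (j - k) * m" for j
    by (auto simp: algebra_simps)
  then show ?thesis
    by (auto simp: residue_class_def) (metis add_diff_cancel)
qed

lemma mem_residue_class_mod: "n \<in> residue_class (n mod m) m"
proof -
  have "n = n mod m + (n div m) * m" by simp
  then show ?thesis unfolding residue_class_def by blast
qed

lemma normalized_coeffs_exist:
  assumes "affine_with_coeffs f S a b c"
  shows "\<exists>p. normalized_coeffs f S p"
proof -
  have c: "c \<noteq> 0" and lin: "\<And>n. n \<in> S \<Longrightarrow> c * f n = a * n + b"
    using assms by (auto simp: affine_with_coeffs_iff)
  \<comment> \<open>Dividing by the signed gcd also makes the denominator positive.\<close>
  define g where "g = sgn c * gcd a (gcd b c)"
  have g: "g \<noteq> 0" using c by (simp add: g_def sgn_eq_0_iff)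
  have abs_g: "\<bar>g\<bar> = gcd a (gcd b c)" using c by (simp add: g_def abs_mult)
  have "g dvd a" "g dvd b" "g dvd c"
    using abs_g by (metis abs_dvd_iff gcd_dvd1 gcd_dvd2 dvd_trans)+
  then obtain a' b' c' where abc: "a = g * a'" "b = g * b'" "c = g * c'"
    by (auto elim!: dvdE)
  have gcd_g: "gcd (g * x) (g * y) = \<bar>g\<bar> * gcd x y" for x y
    by (simp add: gcd_mult_left abs_mult)
  have "\<bar>g\<bar> = gcd (g * a') (gcd (g * b') (g * c'))"
    using abs_g unfolding abc .
  also have "\<dots> = gcd (g * a') \<bar>g * gcd b' c'\<bar>"
    unfolding gcd_g by (simp only: abs_mult abs_gcd_int)
  also have "\<dots> = \<bar>g\<bar> * gcd a' (gcd b' c')"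
    unfolding gcd_abs2_int gcd_g ..
  finally have "\<bar>g\<bar> = \<bar>g\<bar> * gcd a' (gcd b' c')" .
  then have "gcd a' (gcd b' c') = 1" using g by simp
  moreover have "c' > 0"
  proof -
    have "sgn g = sgn c" using c by (simp add: g_def sgn_mult)
    then have "sgn c * sgn c' = sgn c" using abc(3) by (metis sgn_mult)
    then have "sgn c' = 1" using c by (simp add: sgn_eq_0_iff)
    then show ?thesis by (simp add: sgn_1_pos)
  qed
  moreover have "c' * f n = a' * n + b'" if "n \<in> S" for n
  proof -
    have "g * (c' * f n) = g * (a' * n + b')"
      using lin[OF that] by (simp add: abc algebra_simps)
    then show ?thesis using g by simp
  qed
  ultimately have "normalized_coeffs f S (a', b', c')"
    by (simp add: normalized_coeffs_def affine_with_coeffs_iff)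
  then show ?thesis by blast
qed

lemma class_denominator_eq:
  assumes "m > 0" and "normalized_coeffs f (residue_class r m) (a, b, c)"
  shows "class_denominator f r m = c"
proof -
  have "(THE p. normalized_coeffs f (residue_class r m) p) = (a, b, c)"
    using assms normalized_coeffs_unique by (blast intro: the_equality)
  then show ?thesis by (simp add: class_denominator_def)
qed

text \<open>
  If \<open>c\<close> divides \<open>a\<close>, then \<open>c * f n = a * n + b\<close> at one integer \<open>n\<close> already shows that
  \<open>c\<close> divides \<open>b\<close>, so \<open>c\<close> divides the gcd of the three coefficients.
\<close>

lemma normalized_denominator_eq_1:
  assumes "normalized_coeffs f S (a, b, c)" and "n \<in> S" and "c dvd a"
  shows "c = 1"
proof -
  have c: "c > 0" "gcd a (gcd b c) = 1" and lin: "c * f n = a * n + b"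
    using assms by (auto simp: normalized_coeffs_def affine_with_coeffs_iff)
  have "b = c * f n - a * n" using lin by simp
  then have "c dvd b" using \<open>c dvd a\<close> by simp
  then have "c dvd gcd a (gcd b c)" using \<open>c dvd a\<close> by simp
  then show ?thesis using c by simp
qed

text \<open>
  From right to left, the least modulus \<open>M\<close> is compared with \<open>m\<close> by the step from \<open>n\<close> to
  \<open>n + M * m\<close>, which stays in one class for both moduli.
\<close>

lemma rcwa_integral_iff:
  "rcwa_integral f \<longleftrightarrow> (\<exists>m>0. \<forall>n. \<exists>a. \<forall>k. f (n + k * m) = f n + a * (k * m))"
proof
  assume int: "rcwa_integral f"
  define M where "M = rcwa_modulus f"
  have "affine_mod f M"
    using int unfolding rcwa_integral_def residue_class_wise_affine_def M_def rcwa_modulus_def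
    by (metis LeastI_ex)
  then have M: "int M > 0"
    and aff: "\<And>r. r \<in> {0..<int M} \<Longrightarrow> \<exists>a b c. affine_with_coeffs f (residue_class r (int M)) a b c"
    by (auto simp: affine_mod_def)
  have "\<exists>a. \<forall>k. f (n + k * int M) = f n + a * (k * int M)" for n
  proof -
    let ?r = "n mod int M"
    have r: "?r \<in> {0..<int M}" using M by simp
    obtain a b c where norm: "normalized_coeffs f (residue_class ?r (int M)) (a, b, c)"
      using aff[OF r] normalized_coeffs_exist by (metis prod_cases3)
    have "c dvd rcwa_divisor f"
      using r class_denominator_eq[OF M norm] unfolding rcwa_divisor_def M_def
      by (auto intro!: dvd_Lcm)
    then have "c dvd 1" using int by (simp add: rcwa_integral_def)
    then have "c = 1" using norm by (simp add: normalized_coeffs_def)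
    then have lin: "f x = a * x + b" if "x \<in> residue_class ?r (int M)" for x
      using norm that by (simp add: normalized_coeffs_def affine_with_coeffs_iff)
    have "f (n + k * int M) = f n + a * (k * int M)" for k
      using lin[of n] lin[of "n + k * int M"]
      by (simp add: add_mult_mem_residue_class_iff mem_residue_class_mod distrib_left)
    then show ?thesis by blast
  qed
  then show "\<exists>m>0. \<forall>n. \<exists>a. \<forall>k. f (n + k * m) = f n + a * (k * m)" using M by blast
next
  assume "\<exists>m>0. \<forall>n. \<exists>a. \<forall>k. f (n + k * m) = f n + a * (k * m)"
  then obtain m where m: "m > 0"
    and slope: "\<And>n. \<exists>a. \<forall>k. f (n + k * m) = f n + a * (k * m)" by blast
  have "\<exists>a b c. affine_with_coeffs f (residue_class r m) a b c" for r
  proof -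
    obtain a where "\<And>k. f (r + k * m) = f r + a * (k * m)" using slope by blast
    then have "affine_with_coeffs f (residue_class r m) a (f r - a * r) 1"
      by (auto simp: affine_with_coeffs_iff residue_class_def algebra_simps)
    then show ?thesis by blast
  qed
  then have "affine_mod f (nat m)" using m by (simp add: affine_mod_def)
  then have rcwa: "residue_class_wise_affine f"
    by (auto simp: residue_class_wise_affine_def)
  define M where "M = rcwa_modulus f"
  have "affine_mod f M"
    using \<open>affine_mod f (nat m)\<close> unfolding M_def rcwa_modulus_def by (rule LeastI)
  then have M: "int M > 0"
    and aff: "\<And>r. r \<in> {0..<int M} \<Longrightarrow> \<exists>a b c. affine_with_coeffs f (residue_class r (int M)) a b c"
    by (auto simp: affine_mod_def)
  have "class_denominator f r (int M) = 1" if r: "r \<in> {0..<int M}" for r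
  proof -
    obtain a b c where norm: "normalized_coeffs f (residue_class r (int M)) (a, b, c)"
      using aff[OF r] normalized_coeffs_exist by (metis prod_cases3)
    then have lin: "c * f n = a * n + b" if "n \<in> residue_class r (int M)" for n
      using that by (simp add: normalized_coeffs_def affine_with_coeffs_iff)
    have mem: "r + k * int M \<in> residue_class r (int M)" for k
      by (auto simp: residue_class_def)
    obtain d where d: "f (r + int M * m) = f r + d * (int M * m)" using slope by blast
    have "c * f r = a * r + b" using lin[OF mem[of 0]] by simp
    moreover have "c * f (r + int M * m) = a * (r + int M * m) + b"
      using lin[OF mem[of m]] by (simp add: mult.commute)
    ultimately have "(int M * m) * a = (int M * m) * (c * d)"
      unfolding d by algebra
    then have "a = c * d" using M m by simp
    then have "c = 1" using normalized_denominator_eq_1[OF norm mem] by simp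
    then show ?thesis using class_denominator_eq[OF M norm] by simp
  qed
  then have "(\<lambda>r. class_denominator f r (int M)) ` {0..<int M} = {1}"
    using M by force
  then show "rcwa_integral f"
    using rcwa by (simp add: rcwa_integral_def rcwa_divisor_def flip: M_def)
qed

lemma class_transposition_commute:
  assumes "disjoint_classes r1 m1 r2 m2"
  shows "class_transposition r1 m1 r2 m2 = class_transposition r2 m2 r1 m1"
  using assms by (auto simp: disjoint_classes_def class_transposition_def fun_eq_iff)

lemma disjoint_classes_sym: "disjoint_classes r1 m1 r2 m2 \<Longrightarrow> disjoint_classes r2 m2 r1 m1"
  by (auto simp: disjoint_classes_def)

text \<open>
  On the first class the slope is \<open>m2 / m1\<close>; it is measured by the step from \<open>r1\<close> to
  \<open>r1 + m1 * M\<close>, which respects both \<open>m1\<close> and a modulus \<open>M\<close> with integer slopes.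
\<close>

lemma integral_class_transposition_dvd:
  assumes dis: "disjoint_classes r1 m1 r2 m2"
    and int: "rcwa_integral (class_transposition r1 m1 r2 m2)"
  shows "m1 dvd m2"
proof -
  let ?t = "class_transposition r1 m1 r2 m2"
  obtain M a where M: "M > 0" and a: "?t (r1 + m1 * M) = ?t r1 + a * (m1 * M)"
    using int unfolding rcwa_integral_iff by blast
  have "?t r1 = r2"
    using class_transposition_swaps(1)[OF dis, of 0] by simp
  moreover have "?t (r1 + m1 * M) = r2 + m2 * M"
    using class_transposition_swaps(1)[OF dis, of M] by (simp add: mult.commute)
  ultimately have "M * m2 = M * (m1 * a)"
    using a by (simp add: algebra_simps)
  then show ?thesis using M by simp
qed

lemma horizontal_class_transposition_add_mult:
  assumes dis: "disjoint_classes r1 m r2 m"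
  shows "class_transposition r1 m r2 m (n + k * m) = class_transposition r1 m r2 m n + k * m"
proof -
  consider j where "n = r1 + j * m" | j where "n = r2 + j * m"
    | "n \<notin> residue_class r1 m \<union> residue_class r2 m"
    by (auto simp: residue_class_def)
  then show ?thesis
  proof cases
    case 1
    then show ?thesis
      using class_transposition_swaps(1)[OF dis, of j] class_transposition_swaps(1)[OF dis, of "j + k"]
      by (simp add: algebra_simps)
  next
    case 2
    then show ?thesis
      using class_transposition_swaps(2)[OF dis, of j] class_transposition_swaps(2)[OF dis, of "j + k"]
      by (simp add: algebra_simps)
  next
    case 3
    then show ?thesis
      by (simp add: class_transposition_def add_mult_mem_residue_class_iff)
  qed
qed

lemma rcwa_integral_class_transposition_iff:
  assumes dis: "disjoint_classes r1 m1 r2 m2"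
  shows "rcwa_integral (class_transposition r1 m1 r2 m2) \<longleftrightarrow> m1 = m2"
proof
  assume int: "rcwa_integral (class_transposition r1 m1 r2 m2)"
  have "m1 dvd m2" using integral_class_transposition_dvd[OF dis int] .
  moreover have "m2 dvd m1"
    using integral_class_transposition_dvd[OF disjoint_classes_sym[OF dis]] int
    by (simp add: class_transposition_commute[OF dis])
  ultimately show "m1 = m2"
    using dis by (simp add: disjoint_classes_def zdvd_antisym_nonneg)
next
  assume eq: "m1 = m2"
  have "m1 > 0" using dis by (simp add: disjoint_classes_def)
  moreover have "\<forall>k. class_transposition r1 m1 r2 m2 (n + k * m1)
      = class_transposition r1 m1 r2 m2 n + 1 * (k * m1)" for n
    using horizontal_class_transposition_add_mult dis eq by simp
  ultimately show "rcwa_integral (class_transposition r1 m1 r2 m2)"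
    unfolding rcwa_integral_iff by blast
qed

theorem proposition3p4: "CT_inf = CT_int"
proof -
  have "horizontal_class_transpositions = {f \<in> class_transpositions. rcwa_integral f}"
    unfolding horizontal_class_transpositions_def class_transpositions_def
    using rcwa_integral_class_transposition_iff by blast
  then show ?thesis by (simp add: CT_inf_def CT_int_def)
qed

end
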